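(* Let $\underline{S_1}=\lambda n\lambda f\lambda x (f)((n)f)x$. A closed $\lambda$-term $T$ is an $\underline{S_1}$-storage operator iff $T$ is a storage operator.
   Context: Notation: $(t)u$ denotes application of $t$ to $u$, and $(t)u_1\dots u_n$ stands for $(\dots((t)u_1)\dots)u_n$; $\overline{c}$ denotes a finite sequence of terms. $u \succ v$ means $v$ is obtained from $u$ by finitely many head-reduction steps. $(u)^0v=v$, $(u)^{n+1}v=(u)(u)^nv$. Church integers: $\underline{n}=\lambda f\lambda x (f)^n x$. A closed $\lambda$-term $\underline{S}$ is a successor iff $(\underline{S})\underline{k}\simeq_\beta \underline{k+1}$ for every $k\ge 0$ ($\underline{S_1}$ is a successor). A closed $\lambda$-term $T$ is a storage operator iff for every $n\ge 0$ there is a closed $\lambda$-term $\tau_n\simeq_\beta \underline{n}$ such that for every $\theta_n\simeq_\beta\underline{n}$, $(T)\theta_n f \succ (f)\tau_n$ (where $f$ is a fresh variable). $\lambda X$-terms: terms built from variables and constants $X_i$ ($i\ge 0$) by abstraction and application, together with constants $X_{n,a,b,\overline{c}}$ for every $n\in\mathbb N$ and $\lambda X$-terms $a,b,\overline{c}$ ($X_{n,a,b,\overline{c}}$ is regarded as a constant not occurring in $a,b,\overline{c}$). Given a successor $\underline{S}$, a closed $\lambda$-term $T$ is an $\underline{S}$-storage operator iff for every $n\ge 0$ there is a finite sequence of head reductions $U_i\succ V_i$ ($1\le i\le r$) such that: (1) all $U_i,V_i$ are $\lambda X$-terms; (2) $U_1=(T)X_n f$ and $V_r=(f)\tau_n$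 with $\tau_n$ a closed $\lambda$-term $\beta$-equivalent to $\underline{n}$; (3) for $i<r$, $V_i=(X_n)ab\overline{c}$ or $V_i=(X_{l,a,b,\overline{c}})uv\overline{w}$ with $0\le l\le n-1$; (4) if $V_i=(X_n)ab\overline{c}$ then $U_{i+1}=(\underline{0})ab\overline{c}$ if $n=0$ and $U_{i+1}=((\underline{S})X_{n-1,a,b,\overline{c}})ab\overline{c}$ if $n\ne 0$; (5) if $V_i=(X_{l,a,b,\overline{c}})uv\overline{w}$ then $U_{i+1}=(\underline{0})uv\overline{w}$ if $l=0$ and $U_{i+1}=((\underline{S})X_{l-1,u,v,\overline{w}})uv\overline{w}$ if $l\ne 0$. *)

theory Defs
  imports Main
begin

section \<open>The untyped lambda calculus\<close>

text \<open>Terms modulo alpha-equivalence, as de Bruijn terms.\<close>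

datatype lam =
    Var nat
  | App lam lam
  | Abs lam

primrec fv :: "lam \<Rightarrow> nat set" where
  "fv (Var i) = {i}"
| "fv (App s t) = fv s \<union> fv t"
| "fv (Abs s) = {i. Suc i \<in> fv s}"

definition closed :: "lam \<Rightarrow> bool" where
  "closed t \<longleftrightarrow> fv t = {}"

primrec lift :: "lam \<Rightarrow> nat \<Rightarrow> lam" where
  "lift (Var i) k = (if i < k then Var i else Var (Suc i))"
| "lift (App s t) k = App (lift s k) (lift t k)"
| "lift (Abs s) k = Abs (lift s (Suc k))"

primrec subst :: "lam \<Rightarrow> lam \<Rightarrow> nat \<Rightarrow> lam" where
  "subst (Var i) u k = (if k < i then Var (i - 1) else if i = k then u else Var i)"
| "subst (App s t) u k = App (subst s u k) (subst t u k)"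
| "subst (Abs s) u k = Abs (subst s (lift u 0) (Suc k))"

inductive beta :: "lam \<Rightarrow> lam \<Rightarrow> bool" where
  beta: "beta (App (Abs s) t) (subst s t 0)"
| appL: "beta s s' \<Longrightarrow> beta (App s t) (App s' t)"
| appR: "beta t t' \<Longrightarrow> beta (App s t) (App s t')"
| abs: "beta s s' \<Longrightarrow> beta (Abs s) (Abs s')"

abbreviation beta_eq :: "lam \<Rightarrow> lam \<Rightarrow> bool" (infix "\<simeq>\<^sub>\<beta>" 50) where
  "s \<simeq>\<^sub>\<beta> t \<equiv> equivclp beta s t"

text \<open>
  One step contracts the head redex, i.e. the redex \<open>(\<lambda>x. u) v\<close> of a term of the form
  \<open>\<lambda>x\<^sub>1 \<dots> x\<^sub>k. (\<lambda>x. u) v w\<^sub>1 \<dots> w\<^sub>m\<close>. In rule \<open>appL\<close> the function part must not be an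
  abstraction, as otherwise the application itself is the head redex.
\<close>

inductive head_step :: "lam \<Rightarrow> lam \<Rightarrow> bool" where
  beta: "head_step (App (Abs s) t) (subst s t 0)"
| appL: "head_step s s' \<Longrightarrow> \<forall>u. s \<noteq> Abs u \<Longrightarrow> head_step (App s t) (App s' t)"
| abs: "head_step s s' \<Longrightarrow> head_step (Abs s) (Abs s')"

abbreviation head_red :: "lam \<Rightarrow> lam \<Rightarrow> bool" (infix "\<succ>" 50) where
  "s \<succ> t \<equiv> head_step\<^sup>*\<^sup>* s t"


section \<open>Integers, successors, storage operators\<close>

definition church :: "nat \<Rightarrow> lam" where
  "church n = Abs (Abs ((App (Var 1) ^^ n) (Var 0)))"

definition successor :: "lam \<Rightarrow> bool" where
  "successor S \<longleftrightarrow> closed S \<and> (\<forall>k. App S (church k) \<simeq>\<^sub>\<beta> church (k + 1))"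

text \<open>\<open>\<lambda>n f x. f (n f x)\<close>\<close>

definition S1 :: lam where
  "S1 = Abs (Abs (Abs (App (Var 1) (App (App (Var 2) (Var 1)) (Var 0)))))"

text \<open>
  The terms \<open>\<theta>\<close> need not be closed, so freshness of \<open>f\<close> is a real condition.
\<close>

definition storage_operator :: "lam \<Rightarrow> bool" where
  "storage_operator T \<longleftrightarrow> closed T \<and>
     (\<forall>n. \<exists>\<tau>. closed \<tau> \<and> \<tau> \<simeq>\<^sub>\<beta> church n \<and>
        (\<forall>\<theta> f. \<theta> \<simeq>\<^sub>\<beta> church n \<longrightarrow> f \<notin> fv \<theta> \<longrightarrow>
           App (App T \<theta>) (Var f) \<succ> App (Var f) \<tau>))"


section \<open>Terms with constants\<close>

text \<open>
  \<open>XCon n\<close> is the constant \<open>X\<^sub>n\<close> and \<open>XInd n a b cs\<close> is the constant indexed by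
  \<open>n\<close>, \<open>a\<close>, \<open>b\<close> and the finite sequence \<open>cs\<close>. The terms in the index are only labels:
  lifting and substitution leave both kinds of constants unchanged.
\<close>

datatype xlam =
    XVar nat
  | XApp xlam xlam
  | XAbs xlam
  | XCon nat
  | XInd nat xlam xlam "xlam list"

primrec xlift :: "xlam \<Rightarrow> nat \<Rightarrow> xlam" where
  "xlift (XVar i) k = (if i < k then XVar i else XVar (Suc i))"
| "xlift (XApp s t) k = XApp (xlift s k) (xlift t k)"
| "xlift (XAbs s) k = XAbs (xlift s (Suc k))"
| "xlift (XCon n) k = XCon n"
| "xlift (XInd n a b cs) k = XInd n a b cs"

primrec xsubst :: "xlam \<Rightarrow> xlam \<Rightarrow> nat \<Rightarrow> xlam" where
  "xsubst (XVar i) u k = (if k < i then XVar (i - 1) else if i = k then u else XVar i)"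
| "xsubst (XApp s t) u k = XApp (xsubst s u k) (xsubst t u k)"
| "xsubst (XAbs s) u k = XAbs (xsubst s (xlift u 0) (Suc k))"
| "xsubst (XCon n) u k = XCon n"
| "xsubst (XInd n a b cs) u k = XInd n a b cs"

inductive xhead_step :: "xlam \<Rightarrow> xlam \<Rightarrow> bool" where
  beta: "xhead_step (XApp (XAbs s) t) (xsubst s t 0)"
| appL: "xhead_step s s' \<Longrightarrow> \<forall>u. s \<noteq> XAbs u \<Longrightarrow> xhead_step (XApp s t) (XApp s' t)"
| abs: "xhead_step s s' \<Longrightarrow> xhead_step (XAbs s) (XAbs s')"

abbreviation xhead_red :: "xlam \<Rightarrow> xlam \<Rightarrow> bool" (infix "\<succ>\<^sub>X" 50) where
  "s \<succ>\<^sub>X t \<equiv> xhead_step\<^sup>*\<^sup>* s t"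

primrec emb :: "lam \<Rightarrow> xlam" where
  "emb (Var i) = XVar i"
| "emb (App s t) = XApp (emb s) (emb t)"
| "emb (Abs s) = XAbs (emb s)"

abbreviation xapps :: "xlam \<Rightarrow> xlam list \<Rightarrow> xlam" where
  "xapps t us \<equiv> foldl XApp t us"

text \<open>
  The notion is meant for a successor \<open>S\<close>. Any variable \<open>f\<close> is fresh in \<open>(T) X\<^sub>n f\<close>, since
  \<open>T\<close> is closed. The sequences are indexed by \<open>1, \<dots>, r\<close>; \<open>l < n\<close> stands for
  \<open>0 \<le> l \<le> n - 1\<close>, which is unsatisfiable for \<open>n = 0\<close>.
\<close>

definition S_storage_operator :: "lam \<Rightarrow> lam \<Rightarrow> bool" where
  "S_storage_operator S T \<longleftrightarrow> closed T \<and>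
     (\<forall>n. \<exists>\<tau>. closed \<tau> \<and> \<tau> \<simeq>\<^sub>\<beta> church n \<and>
       (\<forall>f. \<exists>(r::nat) (U :: nat \<Rightarrow> xlam) (V :: nat \<Rightarrow> xlam). 1 \<le> r \<and>
          (\<forall>i\<in>{1..r}. U i \<succ>\<^sub>X V i) \<and>
          U 1 = XApp (XApp (emb T) (XCon n)) (XVar f) \<and>
          V r = XApp (XVar f) (emb \<tau>) \<and>
          (\<forall>i\<in>{1..<r}.
             (\<exists>a b cs. V i = xapps (XCon n) (a # b # cs)) \<or>
             (\<exists>l a b cs u v ws. l < n \<and> V i = xapps (XInd l a b cs) (u # v # ws))) \<and>
          (\<forall>i\<in>{1..<r}. \<forall>a b cs. V i = xapps (XCon n) (a # b # cs) \<longrightarrow>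
             U (i + 1) =
               (if n = 0 then xapps (emb (church 0)) (a # b # cs)
                else xapps (XApp (emb S) (XInd (n - 1) a b cs)) (a # b # cs))) \<and>
          (\<forall>i\<in>{1..<r}. \<forall>l a b cs u v ws. V i = xapps (XInd l a b cs) (u # v # ws) \<longrightarrow>
             U (i + 1) =
               (if l = 0 then xapps (emb (church 0)) (u # v # ws)
                else xapps (XApp (emb S) (XInd (l - 1) u v ws)) (u # v # ws)))))"


section \<open>\<open>S1\<close> is a successor\<close>

lemma lift_funpow: "lift ((App g ^^ n) x) k = (App (lift g k) ^^ n) (lift x k)"
  by (induction n) auto

lemma subst_funpow: "subst ((App g ^^ n) x) u k = (App (subst g u k) ^^ n) (subst x u k)"
  by (induction n) auto

lemma lift_church: "lift (church n) k = church n"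
  by (simp add: church_def lift_funpow)

lemma successor_S1: "successor S1"
proof -
  have "App S1 (church k) \<simeq>\<^sub>\<beta> church (k + 1)" for k
  proof -
    let ?C = "\<lambda>t. Abs (Abs (App (Var 1) t))"
    have ctx: "beta (?C s) (?C t)" if "beta s t" for s t
      using that by (intro beta.abs beta.appR)
    have 1: "beta (App S1 (church k)) (?C (App (App (church k) (Var 1)) (Var 0)))"
      using beta.beta[of "Abs (Abs (App (Var 1) (App (App (Var 2) (Var 1)) (Var 0))))" "church k"]
      by (simp add: S1_def lift_church numeral_2_eq_2)
    have "beta (App (church k) (Var 1)) (Abs ((App (Var 2) ^^ k) (Var 0)))"
      using beta.beta[of "Abs ((App (Var 1) ^^ k) (Var 0))" "Var 1"]
      by (simp add: church_def subst_funpow numeral_2_eq_2)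
    then have 2: "beta (?C (App (App (church k) (Var 1)) (Var 0)))
                   (?C (App (Abs ((App (Var 2) ^^ k) (Var 0))) (Var 0)))"
      by (intro ctx beta.appL)
    have "beta (App (Abs ((App (Var 2) ^^ k) (Var 0))) (Var 0)) ((App (Var 1) ^^ k) (Var 0))"
      using beta.beta[of "(App (Var 2) ^^ k) (Var 0)" "Var 0"]
      by (simp add: subst_funpow)
    then have 3: "beta (?C (App (Abs ((App (Var 2) ^^ k) (Var 0))) (Var 0))) (church (k + 1))"
      using ctx by (fastforce simp: church_def)
    from 1 2 3 show ?thesis
      by (meson equivclp_trans r_into_equivclp)
  qed
  moreover have "closed S1"
    by (auto simp: closed_def S1_def)
  ultimately show ?thesis
    by (simp add: successor_def)
qed

end

theory Submission
  imports Defs "HOL-Library.Confluence"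
begin

text \<open>
  From \<open>S1\<close>-storage operators to storage operators: by standardization, any
  \<open>\<theta> \<simeq>\<^sub>\<beta> n\<close> satisfies \<open>\<theta> a b cs \<succ> w\<^sub>n[a/f, b/x] cs\<close>, where
  \<open>w\<^sub>0 \<succ> x\<close> and \<open>w\<^sub>l \<succ> f w\<^sub>l\<^sub>-\<^sub>1\<close>; so the sequence
  of head reductions on constants is simulated by reading \<open>X\<^sub>n\<close> as \<open>\<theta>\<close> and
  \<open>X\<^bsub>l,a,b,cs\<^esub> a b\<close> as \<open>w\<^sub>l[a/f, b/x]\<close>.

  Conversely, take \<open>\<theta> = S1\<^sup>n ((\<lambda>y. 0) z)\<close> with a fresh variable \<open>z\<close>. Reading
  \<open>X\<^sub>n\<close> as \<open>\<theta>\<close> and \<open>X\<^bsub>l,a,b,cs\<^esub>\<close> as \<open>S1\<^sup>l ((\<lambda>y. 0) z)\<close> turns the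
  reduction with constants literally into the reduction of \<open>T \<theta> f\<close>, so that it is finite.
  Its result \<open>f \<tau>\<close> comes from a term without constants, as \<open>z\<close> does not occur in the
  closed term \<open>\<tau>\<close>.
\<close>

section \<open>Substitution\<close>

lemma lift_lift: "i \<le> k \<Longrightarrow> lift (lift t i) (Suc k) = lift (lift t k) i"
  by (induction t arbitrary: i k) auto

lemma subst_lift_cancel [simp]: "subst (lift t k) u k = t"
  by (induction t arbitrary: k u) auto

lemma lift_subst_le: "j \<le> i \<Longrightarrow> lift (subst t u j) i = subst (lift t (Suc i)) (lift u i) j"
  by (induction t arbitrary: i j u) (auto simp: lift_lift)

lemma lift_subst_ge: "i \<le> j \<Longrightarrow> lift (subst t u j) i = subst (lift t i) (lift u i) (Suc j)"
  by (induction t arbitrary: i j u) (auto simp: lift_lift)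

lemma subst_subst:
  "i \<le> j \<Longrightarrow> subst (subst t u i) v j = subst (subst t (lift v i) (Suc j)) (subst u v j) i"
proof (induction t arbitrary: i j u v)
  case (Abs t)
  then show ?case
    by (simp add: lift_lift lift_subst_ge)
qed auto

lemma subst_church: "subst (church n) u k = church n"
  by (simp add: church_def subst_funpow)


section \<open>Confluence\<close>

text \<open>Parallel reduction of Tait and Martin-Loef: any set of redexes present in the term is
  contracted at once. Its reflexive-transitive closure is that of \<open>beta\<close>, but it has a
  one-step diamond.\<close>

inductive par :: "lam \<Rightarrow> lam \<Rightarrow> bool" where
  var: "par (Var i) (Var i)"
| app: "par s s' \<Longrightarrow> par t t' \<Longrightarrow> par (App s t) (App s' t')"
| abs: "par s s' \<Longrightarrow> par (Abs s) (Abs s')"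
| beta: "par s s' \<Longrightarrow> par t t' \<Longrightarrow> par (App (Abs s) t) (subst s' t' 0)"

lemma par_refl: "par t t"
  by (induction t) (auto intro: par.intros)

lemma par_lift: "par s t \<Longrightarrow> par (lift s k) (lift t k)"
proof (induction arbitrary: k rule: par.induct)
  case (beta s s' t t')
  then show ?case
    using par.beta[of "lift s (Suc k)" "lift s' (Suc k)" "lift t k" "lift t' k"]
    by (simp add: lift_subst_le)
qed (auto intro: par.intros)

lemma par_subst: "par s s' \<Longrightarrow> par u u' \<Longrightarrow> par (subst s u k) (subst s' u' k)"
proof (induction arbitrary: u u' k rule: par.induct)
  case (beta s s' t t')
  have "par (subst s (lift u 0) (Suc k)) (subst s' (lift u' 0) (Suc k))"
    "par (subst t u k) (subst t' u' k)"
    using beta by (auto intro: par_lift)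
  from par.beta[OF this] show ?case
    by (simp add: subst_subst)
next
  case (abs s s')
  then show ?case
    using par_lift by (auto intro!: par.abs abs.IH)
qed (auto intro: par.intros)

text \<open>Takahashi's complete development, which contracts all redexes present in the
  term.\<close>

fun dev :: "lam \<Rightarrow> lam" where
  "dev (Var i) = Var i"
| "dev (App (Abs s) t) = subst (dev s) (dev t) 0"
| "dev (App s t) = App (dev s) (dev t)"
| "dev (Abs s) = Abs (dev s)"

inductive_cases par_AbsE: "par (Abs s) t"

text \<open>Triangle property: the redexes that one parallel step leaves over can be contracted by
  the next. Since \<open>dev s\<close> depends on \<open>s\<close> alone, it is a common reduct of
  all parallel reducts of \<open>s\<close>.\<close>

lemma par_dev: "par s t \<Longrightarrow> par t (dev s)"
proof (induction rule: par.induct)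
  case (app s s' t t')
  show ?case
  proof (cases s)
    case (Abs r)
    with app.hyps obtain r' where r': "s' = Abs r'"
      by (auto elim: par_AbsE)
    with app.IH Abs have "par r' (dev r)"
      by (auto elim: par_AbsE)
    with app.IH Abs r' show ?thesis
      by (auto intro: par.beta)
  qed (use app in \<open>auto intro: par.intros\<close>)
qed (auto intro: par.intros par_subst)

text \<open>The triangle property makes \<open>par\<close> strongly confluent, and confluence passes
  to \<open>beta\<close> because the closures coincide.\<close>

lemma confluentp_beta: "confluentp beta"
proof -
  have 1: "par s t" if "beta s t" for s t
    using that by induction (auto intro: par.intros par_refl)
  have app: "beta\<^sup>*\<^sup>* (App s t) (App s' t')" if "beta\<^sup>*\<^sup>* s s'" "beta\<^sup>*\<^sup>* t t'" for s s' t t'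
  proof -
    have "beta\<^sup>*\<^sup>* (App s t) (App s' t)"
      using that(1) by induction (auto intro: beta.appL rtranclp.rtrancl_into_rtrancl)
    moreover have "beta\<^sup>*\<^sup>* (App s' t) (App s' t')"
      using that(2) by induction (auto intro: beta.appR rtranclp.rtrancl_into_rtrancl)
    ultimately show ?thesis by (rule rtranclp_trans)
  qed
  have abs: "beta\<^sup>*\<^sup>* (Abs s) (Abs s')" if "beta\<^sup>*\<^sup>* s s'" for s s'
    using that by induction (auto intro: beta.abs rtranclp.rtrancl_into_rtrancl)
  have 2: "beta\<^sup>*\<^sup>* s t" if "par s t" for s t
    using that
    by induction (auto intro: app abs beta.beta rtranclp.rtrancl_into_rtrancl)
  have "par\<^sup>*\<^sup>* = beta\<^sup>*\<^sup>*"
    using 1 2 by (intro rtranclp_subset) auto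
  moreover have "strong_confluentp par"
    by (rule strong_confluentpI) (use par_dev in blast)
  ultimately show ?thesis
    using confluentpD[OF strong_confluentp_imp_confluentp, of par] by (auto intro!: confluentpI)
qed

section \<open>Church integers as beta-normal forms\<close>

inductive_cases beta_VarE: "beta (Var i) t"
inductive_cases beta_AppE: "beta (App s t) u"
inductive_cases beta_AbsE: "beta (Abs s) t"

lemma church_normal: "\<not> beta (church n) t"
proof -
  have "\<not> beta ((App (Var 1) ^^ n) (Var 0)) t" for t
  proof (induction n arbitrary: t)
    case (Suc n)
    then show ?case by (auto elim: beta_AppE beta_VarE)
  qed (auto elim: beta_VarE)
  then show ?thesis
    unfolding church_def by (auto elim!: beta_AbsE)
qed

text \<open>Confluence yields a common reduct, and the normal term \<open>church n\<close> reduces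
  only to itself.\<close>

lemma beta_eq_church_reduces:
  assumes "t \<simeq>\<^sub>\<beta> church n"
  shows "beta\<^sup>*\<^sup>* t (church n)"
proof -
  have "(beta\<^sup>*\<^sup>* OO beta\<inverse>\<inverse>\<^sup>*\<^sup>*) t (church n)"
    using semiconfluentp_equivclp[OF confluentp_imp_semiconfluentp[OF confluentp_beta]] assms
    by simp
  then obtain u where "beta\<^sup>*\<^sup>* t u" "beta\<^sup>*\<^sup>* (church n) u"
    by (auto simp: rtranclp_conversep)
  then show ?thesis
    by (metis church_normal converse_rtranclpE)
qed


section \<open>Weak head reduction and standardization\<close>

text \<open>
  Without the rule for abstractions, head reduction is closed under application contexts
  and substitution, and reductions to a term that is not an abstraction use no other steps.
\<close>

inductive whead :: "lam \<Rightarrow> lam \<Rightarrow> bool" where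
  beta: "whead (App (Abs s) t) (subst s t 0)"
| appL: "whead s s' \<Longrightarrow> whead (App s t) (App s' t)"

inductive_cases whead_VarE [elim!]: "whead (Var i) t"
inductive_cases whead_AbsE [elim!]: "whead (Abs s) t"
inductive_cases whead_AppE: "whead (App s t) u"

lemma rtranclp_normal: "r\<^sup>*\<^sup>* x y \<Longrightarrow> (\<And>z. \<not> r x z) \<Longrightarrow> y = x"
  by (erule converse_rtranclpE) auto

text \<open>Determinism puts all reducts of \<open>a\<close> on a single path, and the irreducible
  \<open>c\<close> is its end.\<close>

lemma rtranclp_deterministic:
  assumes "\<And>x y z. r x y \<Longrightarrow> r x z \<Longrightarrow> y = z"
    and "r\<^sup>*\<^sup>* a b" "r\<^sup>*\<^sup>* a c" "\<And>d. \<not> r c d"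
  shows "r\<^sup>*\<^sup>* b c"
  using assms(2,3)
proof (induction rule: rtranclp_induct)
  case (step y z)
  then have "r\<^sup>*\<^sup>* y c" "r y z" by auto
  then show ?case
    using assms(1,4) by (metis converse_rtranclpE)
qed

lemma whead_deterministic: "whead s t \<Longrightarrow> whead s t' \<Longrightarrow> t = t'"
proof (induction arbitrary: t' rule: whead.induct)
  case (appL s s' t)
  from appL.prems show ?case
    by (rule whead_AppE) (use appL.hyps appL.IH in blast)+
qed (auto elim: whead_AppE)

lemma whead_Abs_rtranclp: "whead\<^sup>*\<^sup>* (Abs s) t \<Longrightarrow> t = Abs s"
  by (erule rtranclp_normal) auto

lemma whead_head_step: "whead s t \<Longrightarrow> head_step s t"
  by (induction rule: whead.induct) (auto intro: head_step.intros)

lemma head_step_whead: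
  "head_step s t \<Longrightarrow> (\<exists>u u'. s = Abs u \<and> t = Abs u') \<or> whead s t"
  by (induction rule: head_step.induct) (auto intro: whead.intros)

text \<open>An abstraction head-reduces only to abstractions, so a reduction that ends elsewhere
  never works inside one.\<close>

lemma head_red_iff_whead:
  assumes "\<And>u. t \<noteq> Abs u"
  shows "s \<succ> t \<longleftrightarrow> whead\<^sup>*\<^sup>* s t"
proof
  assume "s \<succ> t"
  then show "whead\<^sup>*\<^sup>* s t"
  proof (induction rule: converse_rtranclp_induct)
    case (step s s')
    then show ?case
      using head_step_whead[of s s'] whead_Abs_rtranclp assms
      by (metis converse_rtranclp_into_rtranclp)
  qed simp
next
  assume "whead\<^sup>*\<^sup>* s t"
  then show "s \<succ> t"
    using whead_head_step by (metis mono_rtranclp)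
qed

lemma whead_rtranclp_App: "whead\<^sup>*\<^sup>* s s' \<Longrightarrow> whead\<^sup>*\<^sup>* (App s t) (App s' t)"
  by (induction rule: rtranclp_induct) (auto intro: whead.appL rtranclp.rtrancl_into_rtrancl)

lemma whead_rtranclp_apps:
  "whead\<^sup>*\<^sup>* s s' \<Longrightarrow> whead\<^sup>*\<^sup>* (foldl App s ts) (foldl App s' ts)"
  by (induction ts arbitrary: s s') (auto intro: whead_rtranclp_App)

lemma apps_normal:
  assumes "\<And>u. h \<noteq> Abs u" "\<And>t. \<not> whead h t"
  shows "\<not> whead (foldl App h us) t"
  using assms by (induction us arbitrary: h) (auto elim: whead_AppE)

lemma whead_lift: "whead s t \<Longrightarrow> whead (lift s k) (lift t k)"
  by (induction rule: whead.induct) (auto simp: lift_subst_le intro: whead.intros)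

lemma whead_subst: "whead s t \<Longrightarrow> whead (subst s u k) (subst t u k)"
  by (induction rule: whead.induct) (auto simp: subst_subst intro: whead.intros)

lemma whead_rtranclp_lift: "whead\<^sup>*\<^sup>* s t \<Longrightarrow> whead\<^sup>*\<^sup>* (lift s k) (lift t k)"
  by (induction rule: rtranclp_induct) (auto intro: whead_lift rtranclp.rtrancl_into_rtrancl)

lemma whead_rtranclp_subst: "whead\<^sup>*\<^sup>* s t \<Longrightarrow> whead\<^sup>*\<^sup>* (subst s u k) (subst t u k)"
  by (induction rule: rtranclp_induct) (auto intro: whead_subst rtranclp.rtrancl_into_rtrancl)

section \<open>Standard reductions\<close>

text \<open>Standard reduction, organised by its target: weak head steps first produce the outermost
  constructor of the target, then the components are reduced in the same manner.\<close>

inductive std :: "lam \<Rightarrow> lam \<Rightarrow> bool" where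
  var: "whead\<^sup>*\<^sup>* s (Var i) \<Longrightarrow> std s (Var i)"
| app: "whead\<^sup>*\<^sup>* s (App p q) \<Longrightarrow> std p p' \<Longrightarrow> std q q' \<Longrightarrow> std s (App p' q')"
| abs: "whead\<^sup>*\<^sup>* s (Abs p) \<Longrightarrow> std p p' \<Longrightarrow> std s (Abs p')"

inductive_cases std_VarE: "std s (Var i)"
inductive_cases std_AppE: "std s (App p q)"
inductive_cases std_AbsE: "std s (Abs p)"

lemma std_refl: "std t t"
  by (induction t) (auto intro: std.intros)

lemma whead_std: "whead\<^sup>*\<^sup>* s t \<Longrightarrow> std t u \<Longrightarrow> std s u"
  by (erule std.cases) (auto intro: std.intros rtranclp_trans)

lemma std_lift: "std s t \<Longrightarrow> std (lift s k) (lift t k)"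
proof (induction arbitrary: k rule: std.induct)
  case (var s i)
  then show ?case
    using whead_rtranclp_lift[of s "Var i" k] by (auto intro: std.intros split: if_splits)
next
  case (app s p q p' q')
  then show ?case
    using whead_rtranclp_lift[of s "App p q" k] by (auto intro: std.intros)
next
  case (abs s p p')
  then show ?case
    using whead_rtranclp_lift[of s "Abs p" k] by (auto intro: std.intros)
qed

lemma std_subst: "std s s' \<Longrightarrow> std u u' \<Longrightarrow> std (subst s u k) (subst s' u' k)"
proof (induction arbitrary: u u' k rule: std.induct)
  case (var s i)
  have "whead\<^sup>*\<^sup>* (subst s u k) (subst (Var i) u k)"
    using var by (intro whead_rtranclp_subst)
  moreover have "std (subst (Var i) u k) (subst (Var i) u' k)"
    using var by (auto intro: std_refl)
  ultimately show ?case by (rule whead_std)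
next
  case (app s p q p' q')
  then show ?case
    using whead_rtranclp_subst[of s "App p q" u k] by (auto intro: std.intros)
next
  case (abs s p p')
  then show ?case
    using whead_rtranclp_subst[of s "Abs p" u k] by (auto intro!: std.abs abs.IH std_lift abs.prems)
qed

text \<open>A beta step after a standard reduction can be absorbed. If the contracted redex is at
  the root, weak head steps already expose a redex with arguments standard-reducing to the given
  ones, and contracting it is one more weak head step.\<close>

lemma std_beta: "beta t t' \<Longrightarrow> std s t \<Longrightarrow> std s t'"
proof (induction arbitrary: s rule: beta.induct)
  case (beta a b)
  then obtain p q where 1: "whead\<^sup>*\<^sup>* s (App p q)" "std p (Abs a)" "std q b"
    by (auto elim: std_AppE)
  then obtain p' where 2: "whead\<^sup>*\<^sup>* p (Abs p')" "std p' a"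
    by (auto elim: std_AbsE)
  have "whead\<^sup>*\<^sup>* s (subst p' q 0)"
    using 1(1) whead_rtranclp_App[OF 2(1), of q] whead.beta[of p' q]
    by (meson rtranclp.rtrancl_into_rtrancl rtranclp_trans)
  then show ?case
    using std_subst[OF 2(2) 1(3)] by (rule whead_std)
qed (auto elim!: std_AppE std_AbsE intro: std.intros)

text \<open>The standardization theorem, obtained by absorbing the beta steps one after the
  other.\<close>

lemma rtranclp_beta_std: "beta\<^sup>*\<^sup>* s t \<Longrightarrow> std s t"
  by (induction rule: rtranclp_induct) (auto intro: std_refl std_beta)

section \<open>Standard reductions to Church integers\<close>

abbreviation iter :: "nat \<Rightarrow> lam" where
  "iter n \<equiv> (App (Var 1) ^^ n) (Var 0)"

text \<open>Instantiates the body \<open>w\<close> below the two binders of an integer: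
  \<open>a\<close> replaces index 1, lifted because the inner binder is still present, then
  \<open>b\<close> replaces index 0.\<close>

abbreviation inst2 :: "lam \<Rightarrow> lam \<Rightarrow> lam \<Rightarrow> lam" where
  "inst2 w a b \<equiv> subst (subst w (lift a 0) 1) b 0"

text \<open>Both outer abstractions of \<open>church n\<close> must be exposed by weak head steps.
  The body \<open>w\<close> found below them does not depend on the arguments \<open>a\<close> and
  \<open>b\<close>.\<close>

lemma std_church_apply:
  assumes "std t (church n)"
  obtains w where "std w (iter n)" "\<And>a b. whead\<^sup>*\<^sup>* (App (App t a) b) (inst2 w a b)"
proof -
  obtain p where p: "whead\<^sup>*\<^sup>* t (Abs p)" "std p (Abs (iter n))"
    using assms unfolding church_def by (auto elim: std_AbsE)
  then obtain w where w: "whead\<^sup>*\<^sup>* p (Abs w)" "std w (iter n)"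
    by (auto elim: std_AbsE)
  have "whead\<^sup>*\<^sup>* (App (App t a) b) (inst2 w a b)" for a b
  proof -
    have "whead\<^sup>*\<^sup>* (App t a) (App (Abs p) a)"
      using p(1) by (rule whead_rtranclp_App)
    also have "whead (App (Abs p) a) (subst p a 0)"
      by (rule whead.beta)
    also have "whead\<^sup>*\<^sup>* (subst p a 0) (subst (Abs w) a 0)"
      using w(1) by (rule whead_rtranclp_subst)
    finally have "whead\<^sup>*\<^sup>* (App (App t a) b) (App (Abs (subst w (lift a 0) 1)) b)"
      using whead_rtranclp_App by simp
    also have "whead (App (Abs (subst w (lift a 0) 1)) b) (inst2 w a b)"
      by (rule whead.beta)
    finally show ?thesis .
  qed
  with w(2) show ?thesis by (rule that)
qed

lemma std_iter_0:
  assumes "std w (iter 0)"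
  shows "whead\<^sup>*\<^sup>* (inst2 w a b) b"
proof -
  have "whead\<^sup>*\<^sup>* w (Var 0)" using assms by (auto elim: std_VarE)
  from whead_rtranclp_subst[OF whead_rtranclp_subst[OF this]] show ?thesis
    by (metis One_nat_def less_one subst.simps(1) not_less_zero zero_neq_one)
qed

text \<open>Weak head steps bring the outermost \<open>Var 1\<close> to the head of
  \<open>w\<close>. Its argument \<open>w'\<close> is left as it is and only standard-reduces to the
  remaining iteration.\<close>

lemma std_iter_Suc:
  assumes "std w (iter (Suc n))"
  obtains w' where "std w' (iter n)" "\<And>a b. whead\<^sup>*\<^sup>* (inst2 w a b) (App a (inst2 w' a b))"
proof -
  obtain p w' where "whead\<^sup>*\<^sup>* w (App p w')" "std p (Var 1)" and w': "std w' (iter n)"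
    using assms by (auto elim: std_AppE)
  moreover from this have "whead\<^sup>*\<^sup>* p (Var 1)"
    by (auto elim: std_VarE)
  ultimately have w: "whead\<^sup>*\<^sup>* w (App (Var 1) w')"
    using whead_rtranclp_App by (meson rtranclp_trans)
  have "whead\<^sup>*\<^sup>* (inst2 w a b) (App a (inst2 w' a b))" for a b
    using whead_rtranclp_subst[OF whead_rtranclp_subst[OF w, of "lift a 0" 1], of b 0] by simp
  with w' show ?thesis by (rule that)
qed


section \<open>Terms with constants\<close>

inductive xwhead :: "xlam \<Rightarrow> xlam \<Rightarrow> bool" where
  beta: "xwhead (XApp (XAbs s) t) (xsubst s t 0)"
| appL: "xwhead s s' \<Longrightarrow> xwhead (XApp s t) (XApp s' t)"

inductive_cases xwhead_VarE [elim!]: "xwhead (XVar i) t"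
inductive_cases xwhead_AbsE [elim!]: "xwhead (XAbs s) t"
inductive_cases xwhead_ConE [elim!]: "xwhead (XCon n) t"
inductive_cases xwhead_IndE [elim!]: "xwhead (XInd n a b cs) t"
inductive_cases xwhead_AppE: "xwhead (XApp s t) u"

lemma xwhead_deterministic: "xwhead s t \<Longrightarrow> xwhead s t' \<Longrightarrow> t = t'"
proof (induction arbitrary: t' rule: xwhead.induct)
  case (appL s s' t)
  from appL.prems show ?case
    by (rule xwhead_AppE) (use appL.hyps appL.IH in blast)+
qed (auto elim: xwhead_AppE)

lemma xwhead_Abs_rtranclp: "xwhead\<^sup>*\<^sup>* (XAbs s) t \<Longrightarrow> t = XAbs s"
  by (erule rtranclp_normal) auto

lemma xwhead_xhead_step: "xwhead s t \<Longrightarrow> xhead_step s t"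
  by (induction rule: xwhead.induct) (auto intro: xhead_step.intros)

lemma xhead_step_xwhead:
  "xhead_step s t \<Longrightarrow> (\<exists>u u'. s = XAbs u \<and> t = XAbs u') \<or> xwhead s t"
  by (induction rule: xhead_step.induct) (auto intro: xwhead.intros)

lemma xhead_red_iff_xwhead:
  assumes "\<And>u. t \<noteq> XAbs u"
  shows "s \<succ>\<^sub>X t \<longleftrightarrow> xwhead\<^sup>*\<^sup>* s t"
proof
  assume "s \<succ>\<^sub>X t"
  then show "xwhead\<^sup>*\<^sup>* s t"
  proof (induction rule: converse_rtranclp_induct)
    case (step s s')
    then show ?case
      using xhead_step_xwhead[of s s'] xwhead_Abs_rtranclp assms
      by (metis converse_rtranclp_into_rtranclp)
  qed simp
next
  assume "xwhead\<^sup>*\<^sup>* s t"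
  then show "s \<succ>\<^sub>X t"
    using xwhead_xhead_step by (metis mono_rtranclp)
qed

lemma xwhead_apps: "xwhead s s' \<Longrightarrow> xwhead (xapps s ts) (xapps s' ts)"
  by (induction ts arbitrary: s s') (auto intro: xwhead.appL)

lemma xapps_not_Abs: "(\<And>u. h \<noteq> XAbs u) \<Longrightarrow> xapps h us \<noteq> XAbs u"
  by (induction us arbitrary: h) auto

lemma xapps_normal:
  assumes "\<And>u. h \<noteq> XAbs u" "\<And>t. \<not> xwhead h t"
  shows "\<not> xwhead (xapps h us) t"
  using assms by (induction us arbitrary: h) (auto elim: xwhead_AppE)

lemma xapps_eqD:
  assumes "xapps h us = xapps h' us'" "\<And>s t. h \<noteq> XApp s t" "\<And>s t. h' \<noteq> XApp s t"
  shows "h = h' \<and> us = us'"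
  using assms(1)
proof (induction us arbitrary: us' rule: rev_induct)
  case Nil
  then show ?case using assms(2,3) by (cases us' rule: rev_cases) auto
next
  case (snoc u us)
  show ?case
  proof (cases us' rule: rev_cases)
    case Nil
    then show ?thesis using snoc.prems assms(3) by force
  next
    case (snoc vs v)
    with snoc.prems have "xapps h us = xapps h' vs" "u = v" by simp_all
    with snoc.IH snoc show ?thesis by blast
  qed
qed

lemma xsubst_xlift_cancel [simp]: "xsubst (xlift t k) u k = t"
  by (induction t arbitrary: k u) auto

section \<open>Integer constants and their unfolding\<close>

text \<open>The last argument is the integer that the constant stands for; with it, both kinds of
  constants obey a single unfolding rule.\<close>

inductive num_const :: "nat \<Rightarrow> xlam \<Rightarrow> nat \<Rightarrow> bool" for n where
  con: "num_const n (XCon n) n"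
| ind: "l < n \<Longrightarrow> num_const n (XInd l a b cs) l"

abbreviation unfold_const :: "nat \<Rightarrow> xlam \<Rightarrow> xlam \<Rightarrow> xlam list \<Rightarrow> xlam" where
  "unfold_const m a b cs \<equiv>
     (if m = 0 then xapps (emb (church 0)) (a # b # cs)
      else xapps (XApp (emb S1) (XInd (m - 1) a b cs)) (a # b # cs))"

text \<open>Where head reduction of \<open>unfold_const\<close> leaves the successor or the zero.\<close>

abbreviation unfolded :: "nat \<Rightarrow> xlam \<Rightarrow> xlam \<Rightarrow> xlam list \<Rightarrow> xlam" where
  "unfolded m a b cs \<equiv>
     xapps (if m = 0 then b else XApp a (XApp (XApp (XInd (m - 1) a b cs) a) b)) cs"

lemma num_const_simps:
  assumes "num_const n h m"
  shows "h \<noteq> XAbs u" "h \<noteq> XApp s t" "\<not> xwhead h t"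
  using assms by (auto elim: num_const.cases)

lemma xhead_red_const_iff:
  "num_const n h m \<Longrightarrow> s \<succ>\<^sub>X xapps h us \<longleftrightarrow> xwhead\<^sup>*\<^sup>* s (xapps h us)"
  by (intro xhead_red_iff_xwhead xapps_not_Abs num_const_simps(1))

text \<open>Two head steps for zero, three for the successor. That there is at least one step is
  what makes \<open>realize_progress\<close> a strict advance.\<close>

lemma unfold_const_reduces: "xwhead\<^sup>+\<^sup>+ (unfold_const m a b cs) (unfolded m a b cs)"
proof (cases m)
  case 0
  let ?I = "XAbs (XVar 0)"
  have 1: "xwhead (XApp (XAbs ?I) a) ?I" and 2: "xwhead (XApp ?I b) b"
    using xwhead.beta[of ?I a] xwhead.beta[of "XVar 0" b] by simp_all
  have "xwhead (xapps (XApp (XApp (XAbs ?I) a) b) cs) (xapps (XApp ?I b) cs)"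
    "xwhead (xapps (XApp ?I b) cs) (xapps b cs)"
    using 1 2 by (auto intro: xwhead_apps xwhead.appL)
  then show ?thesis
    using 0 by (auto simp: church_def)
next
  case (Suc l)
  let ?X = "XInd l a b cs"
  let ?N = "XAbs (XAbs (XApp (XVar 1) (XApp (XApp ?X (XVar 1)) (XVar 0))))"
  let ?A = "xlift a 0"
  let ?B = "XAbs (XApp ?A (XApp (XApp ?X ?A) (XVar 0)))"
  have 1: "xwhead (XApp (emb S1) ?X) ?N"
    using xwhead.beta[of "XAbs (XAbs (XApp (XVar 1) (XApp (XApp (XVar 2) (XVar 1)) (XVar 0))))" ?X]
    by (simp add: S1_def numeral_2_eq_2)
  have 2: "xwhead (XApp ?N a) ?B"
    using xwhead.beta[of "XAbs (XApp (XVar 1) (XApp (XApp ?X (XVar 1)) (XVar 0)))" a]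
    by simp
  have 3: "xwhead (XApp ?B b) (XApp a (XApp (XApp ?X a) b))"
    using xwhead.beta[of "XApp ?A (XApp (XApp ?X ?A) (XVar 0))" b] by simp
  have "xwhead (xapps (XApp (XApp (XApp (emb S1) ?X) a) b) cs) (xapps (XApp (XApp ?N a) b) cs)"
    "xwhead (xapps (XApp (XApp ?N a) b) cs) (xapps (XApp ?B b) cs)"
    "xwhead (xapps (XApp ?B b) cs) (xapps (XApp a (XApp (XApp ?X a) b)) cs)"
    using 1 2 3 by (auto intro: xwhead_apps xwhead.appL)
  then show ?thesis
    using Suc by (auto intro: tranclp.trancl_into_trancl)
qed

section \<open>Sequences of head reductions as inductive runs\<close>

inductive run :: "nat \<Rightarrow> xlam \<Rightarrow> xlam \<Rightarrow> bool" for n where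
  halt: "xwhead\<^sup>*\<^sup>* s t \<Longrightarrow> run n s t"
| step: "xwhead\<^sup>*\<^sup>* s (xapps h (a # b # cs)) \<Longrightarrow> num_const n h m \<Longrightarrow>
         run n (unfold_const m a b cs) t \<Longrightarrow> run n s t"

lemma run_prepend:
  assumes "xwhead\<^sup>*\<^sup>* s s'" "run n s' t"
  shows "run n s t"
  using assms(2)
proof cases
  case halt
  with assms(1) show ?thesis by (auto intro: run.halt)
next
  case (step h a b cs m)
  from rtranclp_trans[OF assms(1) step(1)] step(2,3) show ?thesis
    by (rule run.step)
qed

text \<open>Joins the three conditions on a term \<open>V i\<close> and its successor
  \<open>U (i + 1)\<close> into one existential statement.\<close>

definition link :: "nat \<Rightarrow> xlam \<Rightarrow> xlam \<Rightarrow> bool" where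
  "link n v u \<longleftrightarrow>
     (\<exists>h m a b cs. num_const n h m \<and> v = xapps h (a # b # cs) \<and> u = unfold_const m a b cs)"

text \<open>The head and the arguments of a spine are unique, so the universally quantified
  unfolding conditions speak about the one decomposition that exists.\<close>

lemma link_iff:
  "link n v u \<longleftrightarrow>
     ((\<exists>a b cs. v = xapps (XCon n) (a # b # cs)) \<or>
      (\<exists>l a b cs c d ws. l < n \<and> v = xapps (XInd l a b cs) (c # d # ws))) \<and>
     (\<forall>a b cs. v = xapps (XCon n) (a # b # cs) \<longrightarrow> u = unfold_const n a b cs) \<and>
     (\<forall>l a b cs c d ws. v = xapps (XInd l a b cs) (c # d # ws) \<longrightarrow> u = unfold_const l c d ws)"
  (is "_ \<longleftrightarrow> ?ex \<and> ?con \<and> ?ind")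
proof
  assume "link n v u"
  then obtain h m a b cs where h: "num_const n h m" and v: "v = xapps h (a # b # cs)"
    and u: "u = unfold_const m a b cs"
    unfolding link_def by blast
  have eq: "h = h' \<and> a = a' \<and> b = b' \<and> cs = cs'"
    if "v = xapps h' (a' # b' # cs')" "\<And>s t. h' \<noteq> XApp s t" for h' a' b' cs'
    using xapps_eqD[OF v[symmetric, unfolded that(1)] num_const_simps(2)[OF h] that(2)] by blast
  have ?ex
    using h v by cases blast+
  moreover have ?con
    using h u by (auto dest!: eq simp del: foldl_Cons elim: num_const.cases)
  moreover have ?ind
    using h u by (auto dest!: eq simp del: foldl_Cons elim: num_const.cases)
  ultimately show "?ex \<and> ?con \<and> ?ind" by blast
next
  assume *: "?ex \<and> ?con \<and> ?ind"
  then show "link n v u"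
    unfolding link_def using num_const.intros by metis
qed

lemma run_iff_sequences:
  assumes "\<And>u. t \<noteq> XAbs u"
  shows "run n s t \<longleftrightarrow>
    (\<exists>(r::nat) U V. 1 \<le> r \<and> (\<forall>i\<in>{1..r}. U i \<succ>\<^sub>X V i) \<and> U 1 = s \<and> V r = t \<and>
       (\<forall>i\<in>{1..<r}. link n (V i) (U (i + 1))))"
proof
  assume "run n s t"
  then show "\<exists>(r::nat) U V. 1 \<le> r \<and> (\<forall>i\<in>{1..r}. U i \<succ>\<^sub>X V i) \<and> U 1 = s \<and> V r = t \<and>
       (\<forall>i\<in>{1..<r}. link n (V i) (U (i + 1)))"
    using assms
  proof (induction rule: run.induct)
    case (halt s t)
    then show ?case
      by (intro exI[of _ 1] exI[of _ "\<lambda>_. s"] exI[of _ "\<lambda>_. t"]) (simp add: xhead_red_iff_xwhead)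
  next
    case (step s h a b cs m t)
    then obtain r U V where r: "1 \<le> (r::nat)" "\<And>i. i \<in> {1..r} \<Longrightarrow> U i \<succ>\<^sub>X V i"
      "U 1 = unfold_const m a b cs" "V r = t" "\<And>i. i \<in> {1..<r} \<Longrightarrow> link n (V i) (U (i + 1))"
      by blast
    define v where "v = xapps h (a # b # cs)"
    \<comment> \<open>The new pair \<open>s\<close>, \<open>v\<close> gets number 1 and the old
      pairs move up by one; the values at 0 do not matter.\<close>
    define U' where "U' i = (if i \<le> 1 then s else U (i - 1))" for i
    define V' where "V' i = (if i \<le> 1 then v else V (i - 1))" for i
    have "s \<succ>\<^sub>X v"
      unfolding v_def using step.hyps(1) xhead_red_const_iff[OF step.hyps(2)] by blast
    then have "U' i \<succ>\<^sub>X V' i" if "i \<in> {1..r + 1}" for i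
    proof (cases "i = 1")
      case False
      with that have "i - 1 \<in> {1..r}" by auto
      from r(2)[OF this] False that show ?thesis by (simp add: U'_def V'_def)
    qed (simp add: U'_def V'_def)
    moreover have "link n v (U 1)"
      using step.hyps(2) r(3) unfolding link_def v_def by blast
    then have "link n (V' i) (U' (i + 1))" if "i \<in> {1..<r + 1}" for i
    proof (cases "i = 1")
      case False
      with that have "i - 1 \<in> {1..<r}" by auto
      from r(5)[OF this] False that show ?thesis by (simp add: U'_def V'_def)
    qed (simp add: U'_def V'_def)
    moreover have "U' 1 = s" "V' (r + 1) = t"
      using r by (auto simp: U'_def V'_def)
    ultimately show ?case
      by (intro exI[of _ "r + 1"] exI[of _ U'] exI[of _ V']) auto
  qed
next
  assume "\<exists>(r::nat) U V. 1 \<le> r \<and> (\<forall>i\<in>{1..r}. U i \<succ>\<^sub>X V i) \<and> U 1 = s \<and> V r = t \<and>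
       (\<forall>i\<in>{1..<r}. link n (V i) (U (i + 1)))"
  then obtain r U V where r: "1 \<le> (r::nat)" "\<And>i. i \<in> {1..r} \<Longrightarrow> U i \<succ>\<^sub>X V i"
      "U 1 = s" "V r = t" "\<And>i. i \<in> {1..<r} \<Longrightarrow> link n (V i) (U (i + 1))"
    by blast
  \<comment> \<open>Descending induction from \<open>r\<close> to 1 on \<open>run n (U i) t\<close>,
    since a run is built from its end.\<close>
  from r(1) have "run n (U 1) t"
  proof (induction rule: inc_induct)
    case base
    have "U r \<succ>\<^sub>X t" using r(1,2,4) by force
    then show ?case using assms by (simp add: xhead_red_iff_xwhead run.halt)
  next
    case (step i)
    then have "U i \<succ>\<^sub>X V i" "link n (V i) (U (Suc i))"
      using r(2,5)[of i] by auto
    then obtain h m a b cs where h: "num_const n h m" "U i \<succ>\<^sub>X xapps h (a # b # cs)"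
        "U (Suc i) = unfold_const m a b cs"
      unfolding link_def by auto
    from h(2) have "xwhead\<^sup>*\<^sup>* (U i) (xapps h (a # b # cs))"
      using xhead_red_const_iff[OF h(1)] by blast
    then show ?case
      using h(1) step.IH unfolding h(3) by (rule run.step)
  qed
  with r show "run n s t" by simp
qed

lemma S_storage_operator_iff_run:
  "S_storage_operator S1 T \<longleftrightarrow> closed T \<and>
     (\<forall>n. \<exists>\<tau>. closed \<tau> \<and> \<tau> \<simeq>\<^sub>\<beta> church n \<and>
       (\<forall>f. run n (XApp (XApp (emb T) (XCon n)) (XVar f)) (XApp (XVar f) (emb \<tau>))))"
proof -
  have "run n s (XApp p q) \<longleftrightarrow>
    (\<exists>(r::nat) U V. 1 \<le> r \<and> (\<forall>i\<in>{1..r}. U i \<succ>\<^sub>X V i) \<and> U 1 = s \<and> V r = XApp p q \<and>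
       (\<forall>i\<in>{1..<r}. link n (V i) (U (i + 1))))" for n s p q
    by (rule run_iff_sequences) simp
  then show ?thesis
    unfolding S_storage_operator_def by (simp only: link_iff ball_conj_distrib)
qed


section \<open>Instantiating the constants by an arbitrary integer\<close>

text \<open>
  An applied constant \<open>X\<^bsub>l,a,b,cs\<^esub> u v\<close> stands for \<open>w[u/f, v/x]\<close>, where \<open>w\<close>
  standard-reduces to \<open>f\<^sup>l x\<close>.
\<close>

inductive sim :: "nat \<Rightarrow> xlam \<Rightarrow> lam \<Rightarrow> bool" for n where
  var: "sim n (XVar i) (Var i)"
| app: "sim n s s' \<Longrightarrow> sim n t t' \<Longrightarrow> sim n (XApp s t) (App s' t')"
| abs: "sim n s s' \<Longrightarrow> sim n (XAbs s) (Abs s')"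
| con: "std t (church n) \<Longrightarrow> sim n (XCon n) t"
| ind: "std w (iter l) \<Longrightarrow> sim n u u' \<Longrightarrow> sim n v v' \<Longrightarrow>
        sim n (XApp (XApp (XInd l a b cs) u) v) (inst2 w u' v')"

inductive_cases sim_VarE: "sim n (XVar i) t"
inductive_cases sim_AppE: "sim n (XApp p q) t"
inductive_cases sim_AbsE: "sim n (XAbs p) t"
inductive_cases sim_ConE: "sim n (XCon m) t"
inductive_cases sim_IndE: "sim n (XInd l a b cs) t"

text \<open>Rule \<open>ind\<close> relates only constants with two arguments; once that shape is
  excluded, \<open>app\<close> is the only rule left for an application.\<close>

lemma sim_App_cases:
  assumes "sim n (XApp p q) t" "\<And>l a b cs u. p \<noteq> XApp (XInd l a b cs) u"
  obtains p' q' where "t = App p' q'" "sim n p p'" "sim n q q'"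
  using assms(1)
proof cases
  case app
  then show ?thesis using that by blast
next
  case ind
  then show ?thesis using assms(2) by blast
qed

lemma sim_lift: "sim n s t \<Longrightarrow> sim n (xlift s k) (lift t k)"
proof (induction arbitrary: k rule: sim.induct)
  case (con t)
  from std_lift[OF this, of k] show ?case
    by (auto simp: lift_church intro: sim.con)
next
  case (ind w l u u' v v' a b cs)
  have "std (lift w (Suc (Suc k))) (iter l)"
    using std_lift[OF ind.hyps(1), of "Suc (Suc k)"] by (simp add: lift_funpow)
  from sim.ind[OF this ind.IH] show ?case
    by (simp add: lift_subst_le lift_lift)
qed (auto intro: sim.intros)

text \<open>Constants ignore substitution, whereas their images may contain free variables. The
  relation survives because \<open>church n\<close>, and \<open>iter l\<close> below its two
  binders, are unaffected.\<close>

lemma sim_subst: "sim n s t \<Longrightarrow> sim n u u' \<Longrightarrow> sim n (xsubst s u k) (subst t u' k)"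
proof (induction arbitrary: u u' k rule: sim.induct)
  case (abs s s')
  then show ?case by (auto intro!: sim.abs abs.IH sim_lift)
next
  case (con t)
  from std_subst[OF this(1) std_refl, of u' k] show ?case
    by (auto simp: subst_church intro: sim.con)
next
  case (ind w l p p' q q' a b cs)
  \<comment> \<open>The body \<open>w\<close> lies below two binders, hence the double lifting and
    the index raised by two.\<close>
  have "std (subst w (lift (lift u' 0) 0) (Suc (Suc k))) (iter l)"
    using std_subst[OF ind.hyps(1) std_refl, of "lift (lift u' 0) 0" "Suc (Suc k)"]
    by (simp add: subst_funpow)
  from sim.ind[OF this ind.IH] ind.prems show ?case
    by (simp add: subst_subst lift_subst_ge lift_lift)
qed (auto intro: sim.intros)

lemma sim_emb: "sim n (emb t) t"
  by (induction t) (auto intro: sim.intros)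

lemma sim_embD: "sim n (emb t) m \<Longrightarrow> m = t"
proof (induction t arbitrary: m)
  case (App t1 t2)
  have "XApp (XInd l a b cs) u \<noteq> emb t" for l a b cs u t
  proof (cases t)
    case (App p q)
    then show ?thesis by (cases p) auto
  qed auto
  with App.prems obtain p q where "m = App p q" "sim n (emb t1) p" "sim n (emb t2) q"
    by simp (erule sim_App_cases; metis)
  with App.IH show ?case by simp
qed (auto elim: sim_VarE sim_AbsE)

text \<open>A function part that makes a weak head step cannot be a constant applied to one term, so
  the spine is related by \<open>app\<close> down to a redex that has a matching redex in the
  image.\<close>

lemma sim_xwhead:
  assumes "xwhead s s'" "sim n s t"
  obtains t' where "whead\<^sup>*\<^sup>* t t'" "sim n s' t'"
proof -
  have "\<exists>t'. whead\<^sup>*\<^sup>* t t' \<and> sim n s' t'"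
    using assms
  proof (induction arbitrary: t rule: xwhead.induct)
    case (beta s u)
    then obtain p q where "t = App (Abs p) q" "sim n s p" "sim n u q"
      by (auto elim!: sim_AppE sim_AbsE)
    then show ?case
      using whead.beta[of p q] sim_subst by blast
  next
    case (appL s s' u)
    from appL.hyps have "s \<noteq> XApp (XInd l a b cs) v" for l a b cs v
      by (auto elim: xwhead_AppE)
    with appL.prems obtain p q where "t = App p q" "sim n s p" "sim n u q"
      by (rule sim_App_cases)
    with appL.IH[of p] show ?case
      using whead_rtranclp_App sim.app by blast
  qed
  with that show ?thesis by blast
qed

lemma sim_xwhead_rtranclp:
  assumes "xwhead\<^sup>*\<^sup>* s s'" "sim n s t"
  obtains t' where "whead\<^sup>*\<^sup>* t t'" "sim n s' t'"
proof -
  have "\<exists>t'. whead\<^sup>*\<^sup>* t t' \<and> sim n s' t'"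
    using assms
  proof (induction rule: rtranclp_induct)
    case (step y z)
    then show ?case by (meson rtranclp_trans sim_xwhead)
  qed auto
  with that show ?thesis by blast
qed

lemma sim_xapps:
  "sim n s t \<Longrightarrow> list_all2 (sim n) us ts \<Longrightarrow> sim n (xapps s us) (foldl App t ts)"
proof (induction us arbitrary: s t ts)
  case (Cons u us)
  then obtain v vs where "ts = v # vs" "sim n u v" "list_all2 (sim n) us vs"
    by (auto simp: list_all2_Cons1)
  with Cons.IH[OF sim.app[OF Cons.prems(1)]] show ?case by simp
qed simp

text \<open>The image of a constant may absorb its first two arguments, but all later arguments
  correspond one to one.\<close>

lemma sim_xappsD:
  assumes "sim n (xapps h (a # b # cs)) t" "num_const n h m"
  shows "\<exists>t' ts. sim n (XApp (XApp h a) b) t' \<and> list_all2 (sim n) cs ts \<and> t = foldl App t' ts"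
  using assms(1)
proof (induction cs arbitrary: t rule: rev_induct)
  case Nil
  then show ?case by auto
next
  case (snoc c cs)
  have "xapps h (a # b # cs) \<noteq> XApp (XInd l x y zs) u" for l x y zs u
    using xapps_eqD[of h "a # b # cs" "XInd l x y zs" "[u]"] num_const_simps(2)[OF assms(2)]
    by auto
  moreover have "sim n (XApp (xapps h (a # b # cs)) c) t"
    using snoc.prems by simp
  ultimately obtain p q where t: "t = App p q" "sim n (xapps h (a # b # cs)) p" "sim n c q"
    by (elim sim_App_cases) blast
  from snoc.IH[OF t(2)] obtain t' ts where
    "sim n (XApp (XApp h a) b) t'" "list_all2 (sim n) cs ts" "p = foldl App t' ts"
    by blast
  with t show ?case
    by (intro exI[of _ t'] exI[of _ "ts @ [q]"]) (auto intro: list_all2_appendI)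
qed

text \<open>The image of the head with its two arguments reaches \<open>inst2 w a' b'\<close>, after
  exposing the binders if the constant is \<open>XCon n\<close>. The body \<open>w\<close> then
  yields either \<open>b'\<close> or \<open>a'\<close> applied to an instance of a smaller body, and
  that instance is the image of the new constant with its arguments.\<close>

lemma sim_unfolded:
  assumes "num_const n h m" "sim n (xapps h (a # b # cs)) t"
  obtains t' where "whead\<^sup>*\<^sup>* t t'" "sim n (unfolded m a b cs) t'"
proof -
  obtain t1 ts where t1: "sim n (XApp (XApp h a) b) t1" and ts: "list_all2 (sim n) cs ts"
    and t: "t = foldl App t1 ts"
    using sim_xappsD[OF assms(2,1)] by blast
  obtain w a' b' where w: "std w (iter m)" "whead\<^sup>*\<^sup>* t1 (inst2 w a' b')"
    and ab: "sim n a a'" "sim n b b'"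
    using assms(1)
  proof cases
    case con
    with t1 obtain h' a' b' where "std h' (church n)" "sim n a a'" "sim n b b'"
      "t1 = App (App h' a') b'"
      by (auto elim!: sim_AppE sim_ConE)
    moreover from std_church_apply[OF this(1)] obtain w where
      "std w (iter n)" "\<And>a b. whead\<^sup>*\<^sup>* (App (App h' a) b) (inst2 w a b)"
      by blast
    ultimately show ?thesis using that con by blast
  next
    case (ind x y zs)
    with t1 show ?thesis
      by (auto elim!: sim_AppE sim_IndE intro: that)
  qed
  have "\<exists>t2. whead\<^sup>*\<^sup>* t1 t2 \<and> sim n (unfolded m a b cs) (foldl App t2 ts)"
  proof (cases m)
    case 0
    then have "whead\<^sup>*\<^sup>* t1 b'"
      using w std_iter_0[of w a' b'] by auto
    with 0 ab ts show ?thesis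
      by (auto intro: sim_xapps)
  next
    case (Suc l)
    then obtain w' where w': "std w' (iter l)"
      "\<And>a b. whead\<^sup>*\<^sup>* (inst2 w a b) (App a (inst2 w' a b))"
      using std_iter_Suc w(1) by blast
    then have "whead\<^sup>*\<^sup>* t1 (App a' (inst2 w' a' b'))"
      using w(2) by (meson rtranclp_trans)
    moreover have "sim n (XApp a (XApp (XApp (XInd l a b cs) a) b)) (App a' (inst2 w' a' b'))"
      using ab w'(1) by (intro sim.app sim.ind)
    ultimately show ?thesis
      using Suc ts sim_xapps by fastforce
  qed
  with that t whead_rtranclp_apps show ?thesis by blast
qed

text \<open>An unapplied \<open>XInd\<close> constant has no image, so the simulation resumes at
  \<open>unfolded\<close> and not at \<open>unfold_const\<close>. The induction therefore allows any
  reduct \<open>s'\<close> of the start of the run; by determinism \<open>s'\<close> still lies on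
  the way to the next irreducible term.\<close>

lemma run_sim:
  assumes "run n s (XApp (XVar f) (emb \<tau>))" "sim n s t"
  shows "whead\<^sup>*\<^sup>* t (App (Var f) \<tau>)"
proof -
  define g where "g = XApp (XVar f) (emb \<tau>)"
  have prefix: "xwhead\<^sup>*\<^sup>* s' v"
    if "xwhead\<^sup>*\<^sup>* s s'" "xwhead\<^sup>*\<^sup>* s v" "\<And>u. \<not> xwhead v u" for s s' v
    using xwhead_deterministic that by (rule rtranclp_deterministic)
  have main: "whead\<^sup>*\<^sup>* t (App (Var f) \<tau>)"
    if "run n s g" "xwhead\<^sup>*\<^sup>* s s'" "sim n s' t" for s s' t
    using that g_def
  proof (induction arbitrary: s' t rule: run.induct)
    case (halt s g)
    then have "\<not> xwhead g u" for u
      by (auto elim: xwhead_AppE)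
    then have "xwhead\<^sup>*\<^sup>* s' g"
      using prefix halt by blast
    then obtain t' where t': "whead\<^sup>*\<^sup>* t t'" "sim n g t'"
      using halt.prems(2) by (rule sim_xwhead_rtranclp)
    moreover from this(2) have "t' = App (Var f) \<tau>"
      using sim_embD[of n "App (Var f) \<tau>"] halt.prems(3) by simp
    ultimately show ?case by simp
  next
    case (step s h a b cs m g)
    have "\<not> xwhead (xapps h (a # b # cs)) u" for u
      using num_const_simps[OF step.hyps(2)] by (intro xapps_normal) auto
    then have "xwhead\<^sup>*\<^sup>* s' (xapps h (a # b # cs))"
      using prefix step by blast
    then obtain t1 where t1: "whead\<^sup>*\<^sup>* t t1" "sim n (xapps h (a # b # cs)) t1"
      using step.prems(2) by (rule sim_xwhead_rtranclp)
    obtain t2 where t2: "whead\<^sup>*\<^sup>* t1 t2" "sim n (unfolded m a b cs) t2"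
      using step.hyps(2) t1(2) by (rule sim_unfolded)
    have "whead\<^sup>*\<^sup>* t2 (App (Var f) \<tau>)"
      using tranclp_into_rtranclp[OF unfold_const_reduces] t2(2) step.prems(3) by (rule step.IH)
    with t1 t2 show ?case by (meson rtranclp_trans)
  qed
  show ?thesis
    by (rule main[OF assms(1)[folded g_def] rtranclp.rtrancl_refl assms(2)])
qed


section \<open>Instantiating the constants by marked integers\<close>

text \<open>
  These integers reduce in step with the unfolding of the constants, and the
  free variable \<open>z\<close> betrays them in any term.
\<close>

definition marked :: "nat \<Rightarrow> nat \<Rightarrow> lam" where
  "marked z n = (App S1 ^^ n) (App (Abs (church 0)) (Var z))"

lemma fv_marked: "fv (marked z n) = {z}"
proof (induction n)
  case 0
  show ?case by (auto simp: marked_def church_def)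
next
  case (Suc n)
  then show ?case
    using successor_S1 by (simp add: marked_def successor_def closed_def)
qed

lemma marked_beta_eq: "marked z n \<simeq>\<^sub>\<beta> church n"
proof (induction n)
  case 0
  have "beta (marked z 0) (church 0)"
    using beta.beta[of "church 0" "Var z"] by (simp add: marked_def subst_church)
  then show ?case by blast
next
  case (Suc n)
  have "App S1 s \<simeq>\<^sub>\<beta> App S1 t" if "s \<simeq>\<^sub>\<beta> t" for s t
    using that by (induction rule: equivclp_induct) (auto intro: equivclp_into_equivclp beta.appR)
  with Suc have "marked z (Suc n) \<simeq>\<^sub>\<beta> App S1 (church n)"
    by (simp add: marked_def)
  also have "\<dots> \<simeq>\<^sub>\<beta> church (Suc n)"
    using successor_S1 by (simp add: successor_def)
  finally show ?case .
qed

lemma lift_S1: "lift S1 k = S1" and subst_S1: "subst S1 u k = S1"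
  by (simp_all add: S1_def)

lemma lift_marked: "k \<le> z \<Longrightarrow> lift (marked z n) k = marked (Suc z) n"
  by (simp add: marked_def lift_funpow lift_S1 lift_church)

lemma subst_marked: "k \<le> z \<Longrightarrow> subst (marked (Suc z) n) u k = marked z n"
  by (simp add: marked_def subst_funpow subst_S1 subst_church)

text \<open>With fewer than two arguments a marked integer thus ends in an abstraction, never in
  \<open>App (Var f) \<tau>\<close>.\<close>

lemma marked_whead_Abs: "\<exists>t. whead\<^sup>*\<^sup>* (marked z m) (Abs (Abs t))"
proof (cases m)
  case 0
  have "whead (marked z m) (Abs (Abs (Var 0)))"
    using 0 whead.beta[of "church 0" "Var z"] by (simp add: marked_def subst_church) (simp add: church_def)
  then show ?thesis by blast
next
  case (Suc l)
  have "\<exists>t. whead (App S1 u) (Abs (Abs t))" for u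
    using whead.beta[of "Abs (Abs (App (Var 1) (App (App (Var 2) (Var 1)) (Var 0))))" u]
    by (auto simp: S1_def)
  then show ?thesis
    using Suc by (auto simp: marked_def)
qed

section \<open>Realization of constants by marked integers\<close>

text \<open>The index \<open>z\<close> is raised under each binder, so that all marked integers
  contain the same free variable. The labels of a constant are forgotten.\<close>

primrec realize :: "xlam \<Rightarrow> nat \<Rightarrow> lam" where
  "realize (XVar i) = (\<lambda>z. Var i)"
| "realize (XApp s t) = (\<lambda>z. App (realize s z) (realize t z))"
| "realize (XAbs s) = (\<lambda>z. Abs (realize s (Suc z)))"
| "realize (XCon n) = (\<lambda>z. marked z n)"
| "realize (XInd n a b cs) = (\<lambda>z. marked z n)"

lemma realize_xlift: "k \<le> z \<Longrightarrow> realize (xlift s k) (Suc z) = lift (realize s z) k"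
  by (induction s arbitrary: k z) (auto simp: lift_marked)

lemma realize_xsubst:
  "k \<le> z \<Longrightarrow> realize (xsubst s u k) z = subst (realize s (Suc z)) (realize u z) k"
  by (induction s arbitrary: k z u) (auto simp: subst_marked realize_xlift)

lemma realize_emb: "realize (emb t) z = t"
  by (induction t arbitrary: z) auto

lemma realize_xapps: "realize (xapps s us) z = foldl App (realize s z) (map (\<lambda>u. realize u z) us)"
  by (induction us arbitrary: s) auto

text \<open>Every constant leaves an occurrence of \<open>z\<close> behind, so a realization free of
  \<open>z\<close> comes from a term without constants.\<close>

lemma realize_fresh_emb: "z \<notin> fv (realize s z) \<Longrightarrow> emb (realize s z) = s"
  by (induction s arbitrary: z) (auto simp: fv_marked)

lemma realize_xwhead: "xwhead s t \<Longrightarrow> whead (realize s z) (realize t z)"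
  by (induction rule: xwhead.induct) (auto simp: realize_xsubst intro: whead.intros)

lemma realize_xwhead_tranclp: "xwhead\<^sup>+\<^sup>+ s t \<Longrightarrow> whead\<^sup>+\<^sup>+ (realize s z) (realize t z)"
proof (induction rule: tranclp_induct)
  case (step t u)
  from step.IH realize_xwhead[OF step.hyps(2)] show ?case by (rule tranclp.trancl_into_trancl)
qed (blast intro: realize_xwhead)

text \<open>Invariant ensuring that each constant reaching head position satisfies
  \<open>num_const n\<close>; labels are not inspected.\<close>

primrec wf_consts :: "nat \<Rightarrow> xlam \<Rightarrow> bool" where
  "wf_consts n (XVar i) \<longleftrightarrow> True"
| "wf_consts n (XApp s t) \<longleftrightarrow> wf_consts n s \<and> wf_consts n t"
| "wf_consts n (XAbs s) \<longleftrightarrow> wf_consts n s"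
| "wf_consts n (XCon m) \<longleftrightarrow> m = n"
| "wf_consts n (XInd l a b cs) \<longleftrightarrow> l < n"

lemma wf_consts_xlift: "wf_consts n (xlift s k) \<longleftrightarrow> wf_consts n s"
  by (induction s arbitrary: k) auto

lemma wf_consts_xsubst: "wf_consts n s \<Longrightarrow> wf_consts n u \<Longrightarrow> wf_consts n (xsubst s u k)"
  by (induction s arbitrary: k u) (auto simp: wf_consts_xlift)

lemma wf_consts_xwhead: "xwhead s t \<Longrightarrow> wf_consts n s \<Longrightarrow> wf_consts n t"
  by (induction rule: xwhead.induct) (auto simp: wf_consts_xsubst)

lemma wf_consts_xapps: "wf_consts n (xapps s us) \<longleftrightarrow> wf_consts n s \<and> (\<forall>u \<in> set us. wf_consts n u)"
  by (induction us arbitrary: s) auto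

lemma wf_consts_emb: "wf_consts n (emb t)"
  by (induction t) auto

lemma wf_consts_unfolded:
  assumes "num_const n h m" "wf_consts n (xapps h (a # b # cs))"
  shows "wf_consts n (unfolded m a b cs)"
  using assms by (auto simp: wf_consts_xapps elim: num_const.cases)

lemma xlam_head_cases [consumes 1, case_names red abs var const]:
  assumes "wf_consts n s"
  obtains (red) s' where "xwhead s s'"
    | (abs) t where "s = XAbs t"
    | (var) i us where "s = xapps (XVar i) us"
    | (const) h m us where "num_const n h m" "s = xapps h us"
proof -
  have "(\<exists>s'. xwhead s s') \<or> (\<exists>t. s = XAbs t) \<or> (\<exists>i us. s = xapps (XVar i) us) \<or>
    (\<exists>h m us. num_const n h m \<and> s = xapps h us)"
    using assms
  proof (induction s)
    case (XVar i)
    have "XVar i = xapps (XVar i) []" by simp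
    then show ?case by blast
  next
    case (XApp s t)
    have snoc: "XApp (xapps h us) t = xapps h (us @ [t])" for h us by simp
    from XApp consider s' where "xwhead s s'" | u where "s = XAbs u"
      | i us where "s = xapps (XVar i) us" | h m us where "num_const n h m" "s = xapps h us"
      by auto
    then show ?case
    proof cases
      case 1
      then show ?thesis using xwhead.appL by blast
    next
      case 2
      then show ?thesis using xwhead.beta by blast
    next
      case 3
      then show ?thesis using snoc by blast
    next
      case 4
      then show ?thesis using snoc by blast
    qed
  next
    case (XCon m)
    then have "num_const n (XCon m) m" "XCon m = xapps (XCon m) []"
      by (auto intro: num_const.intros)
    then show ?case by blast
  next
    case (XInd l a b cs)
    then have "num_const n (XInd l a b cs) l" "XInd l a b cs = xapps (XInd l a b cs) []"
      by (auto intro: num_const.intros)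
    then show ?case by blast
  qed auto
  with that show ?thesis by blast
qed

lemma whead_unique_normal:
  assumes "whead\<^sup>*\<^sup>* s t" "whead\<^sup>*\<^sup>* s t'" "\<And>u. \<not> whead t u" "\<And>u. \<not> whead t' u"
  shows "t = t'"
proof -
  have "whead\<^sup>*\<^sup>* t t'"
    using whead_deterministic assms(1,2,4) by (rule rtranclp_deterministic)
  from rtranclp_normal[OF this assms(3)] show ?thesis by simp
qed

lemma App_Var_normal: "\<not> whead (App (Var f) t) u"
  using apps_normal[of "Var f" "[t]" u] by auto

text \<open>One round of the run is recovered from the head of \<open>s\<close>. A redex is
  contracted, and a constant with two arguments is unfolded; a variable head means that the end is
  reached, and the other shapes would lead to an abstraction.\<close>

lemma realize_progress:
  assumes "wf_consts n s" "whead\<^sup>*\<^sup>* (realize s z) (App (Var f) \<tau>)" "closed \<tau>"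
  shows "s = XApp (XVar f) (emb \<tau>) \<or>
    (\<exists>w. wf_consts n w \<and> whead\<^sup>+\<^sup>+ (realize s z) (realize w z) \<and> (\<forall>t. run n w t \<longrightarrow> run n s t))"
  using assms(1)
proof (cases rule: xlam_head_cases)
  case (red s')
  from wf_consts_xwhead[OF this assms(1)] have "wf_consts n s'" .
  moreover from realize_xwhead[OF red] have "whead\<^sup>+\<^sup>+ (realize s z) (realize s' z)" by blast
  moreover have "run n s t" if "run n s' t" for t
    using r_into_rtranclp[of xwhead, OF red] that by (rule run_prepend)
  ultimately show ?thesis by blast
next
  case (abs t)
  with assms(2) show ?thesis by (auto dest: whead_Abs_rtranclp)
next
  case (var i us)
  have "\<not> whead (foldl App (Var i) ts) u" for ts u
    by (rule apps_normal) auto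
  then have eq: "realize s z = App (Var f) \<tau>"
    using rtranclp_normal[OF assms(2)] var by (simp add: realize_xapps)
  obtain u where "s = XApp (XVar f) u" "realize u z = \<tau>"
  proof (cases us rule: rev_cases)
    case (snoc vs v)
    with eq var have *: "realize (xapps (XVar i) vs) z = Var f" "realize v z = \<tau>" by auto
    then have "vs = []" by (cases vs rule: rev_cases) auto
    with * snoc var that show ?thesis by simp
  qed (use eq var in auto)
  \<comment> \<open>As \<open>\<tau>\<close> is closed, \<open>z\<close> does not occur in the
    realization of \<open>u\<close>, so \<open>u\<close> contains no constants.\<close>
  moreover from this have "emb \<tau> = u"
    using realize_fresh_emb[of z u] assms(3) by (auto simp: closed_def)
  ultimately show ?thesis by simp
next
  case (const h m us)
  have hd: "realize h z = marked z m"
    using const(1) by cases auto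
  obtain t where t: "whead\<^sup>*\<^sup>* (marked z m) (Abs (Abs t))"
    using marked_whead_Abs by blast
  have no_Abs: "\<not> whead\<^sup>*\<^sup>* (realize s z) (Abs u)" for u
    using whead_unique_normal[OF assms(2), of "Abs u"] App_Var_normal by auto
  consider "us = []" | a where "us = [a]" | a b cs where "us = a # b # cs"
    by (cases us rule: remdups_adj.cases) auto
  then show ?thesis
  proof cases
    case 1
    with const hd t no_Abs show ?thesis by auto
  next
    case (2 a)
    have "whead\<^sup>*\<^sup>* (App (marked z m) (realize a z)) (App (Abs (Abs t)) (realize a z))"
      using t by (rule whead_rtranclp_App)
    also have "whead \<dots> (Abs (subst t (lift (realize a z) 0) 1))"
      using whead.beta[of "Abs t"] by simp
    finally show ?thesis using 2 const hd no_Abs by auto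
  next
    case (3 a b cs)
    let ?u = "unfold_const m a b cs" and ?w = "unfolded m a b cs"
    \<comment> \<open>For \<open>m = 0\<close> the step discarding \<open>z\<close> turns the mark
      into \<open>church 0\<close>; for positive \<open>m\<close> both realizations are the same
      term, since \<open>marked z m\<close> is \<open>S1\<close> applied to the preceding marked
      integer.\<close>
    have "whead\<^sup>*\<^sup>* (realize s z) (realize ?u z)"
    proof (cases m)
      case 0
      have "whead (marked z 0) (church 0)"
        using whead.beta[of "church 0" "Var z"] by (simp add: marked_def subst_church)
      then have "whead\<^sup>*\<^sup>* (foldl App (marked z 0) ts) (foldl App (church 0) ts)" for ts
        by (intro whead_rtranclp_apps r_into_rtranclp)
      moreover have "realize ?u z = foldl App (church 0) (map (\<lambda>u. realize u z) us)"
        using 0 3 by (simp add: realize_xapps realize_emb)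
      ultimately show ?thesis
        using const(2) hd 0 by (simp add: realize_xapps)
    next
      case (Suc l)
      then show ?thesis
        using const(2) 3 hd by (simp add: realize_xapps realize_emb marked_def)
    qed
    also have "whead\<^sup>+\<^sup>+ (realize ?u z) (realize ?w z)"
      using unfold_const_reduces by (rule realize_xwhead_tranclp)
    finally have "whead\<^sup>+\<^sup>+ (realize s z) (realize ?w z)" .
    moreover have "wf_consts n ?w"
      using const 3 assms(1) wf_consts_unfolded by metis
    moreover have "run n s t" if "run n ?w t" for t
    proof -
      have "run n ?u t"
        using tranclp_into_rtranclp[OF unfold_const_reduces] that by (rule run_prepend)
      with const(1) show ?thesis
        unfolding const(2) 3 by (rule run.step[OF rtranclp.rtrancl_refl])
    qed
    ultimately show ?thesis by blast
  qed
qed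

text \<open>The finite reduction to \<open>App (Var f) \<tau>\<close> bounds the number of
  rounds.\<close>

lemma realize_run:
  assumes "whead\<^sup>*\<^sup>* (realize s z) (App (Var f) \<tau>)" "wf_consts n s" "closed \<tau>"
  shows "run n s (XApp (XVar f) (emb \<tau>))"
proof -
  let ?g = "XApp (XVar f) (emb \<tau>)"
  \<comment> \<open>A round may take several weak head steps, so the induction moves
    \<open>x\<close> along the path one step at a time and lets the realization of \<open>s\<close>
    be any term further on.\<close>
  have "run n s ?g" if "whead\<^sup>*\<^sup>* x (App (Var f) \<tau>)" "whead\<^sup>*\<^sup>* x (realize s z)" "wf_consts n s" for x s
    using that
  proof (induction arbitrary: s rule: converse_rtranclp_induct)
    case base
    then have "realize s z = App (Var f) \<tau>"
      using App_Var_normal rtranclp_normal by metis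
    then have "s = ?g"
      using realize_progress[of n s z f \<tau>] base assms(3) App_Var_normal
      by (auto dest!: tranclpD)
    then show ?case by (auto intro: run.halt)
  next
    case (step x y)
    show ?case
    proof (cases "realize s z = x")
      case False
      with step.prems(1) step.hyps(1) have "whead\<^sup>*\<^sup>* y (realize s z)"
        by (metis converse_rtranclpE whead_deterministic)
      then show ?thesis using step.IH step.prems(2) by blast
    next
      case True
      then consider "s = ?g" | w where "wf_consts n w" "whead\<^sup>+\<^sup>+ x (realize w z)"
          "\<forall>t. run n w t \<longrightarrow> run n s t"
        using realize_progress[of n s z f \<tau>] step assms(3)
        by (metis converse_rtranclp_into_rtranclp)
      then show ?thesis
      proof cases
        case 1
        then show ?thesis by (auto intro: run.halt)
      next
        case 2
        from 2(2) step.hyps(1) have "whead\<^sup>*\<^sup>* y (realize w z)"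
          by (metis tranclpD whead_deterministic)
        then show ?thesis using step.IH 2 by blast
      qed
    qed
  qed
  with assms show ?thesis by blast
qed

theorem theorem2:
  fixes T :: lam
  assumes "closed T"
  shows "S_storage_operator S1 T \<longleftrightarrow> storage_operator T"
proof
  assume "S_storage_operator S1 T"
  then have *: "\<exists>\<tau>. closed \<tau> \<and> \<tau> \<simeq>\<^sub>\<beta> church n \<and>
      (\<forall>f. run n (XApp (XApp (emb T) (XCon n)) (XVar f)) (XApp (XVar f) (emb \<tau>)))" for n
    by (simp add: S_storage_operator_iff_run)
  have "\<exists>\<tau>. closed \<tau> \<and> \<tau> \<simeq>\<^sub>\<beta> church n \<and>
      (\<forall>\<theta> f. \<theta> \<simeq>\<^sub>\<beta> church n \<longrightarrow> f \<notin> fv \<theta> \<longrightarrow> App (App T \<theta>) (Var f) \<succ> App (Var f) \<tau>)" for n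
  proof -
    obtain \<tau> where \<tau>: "closed \<tau>" "\<tau> \<simeq>\<^sub>\<beta> church n"
      and run: "\<And>f. run n (XApp (XApp (emb T) (XCon n)) (XVar f)) (XApp (XVar f) (emb \<tau>))"
      using * by blast
    have "App (App T \<theta>) (Var f) \<succ> App (Var f) \<tau>" if "\<theta> \<simeq>\<^sub>\<beta> church n" for \<theta> f
    proof -
      have "std \<theta> (church n)"
        using that by (intro rtranclp_beta_std beta_eq_church_reduces)
      then have "sim n (XApp (XApp (emb T) (XCon n)) (XVar f)) (App (App T \<theta>) (Var f))"
        by (intro sim.app sim.con sim.var sim_emb)
      from run_sim[OF run this] show ?thesis
        by (simp add: head_red_iff_whead)
    qed
    with \<tau> show ?thesis by blast
  qed
  with assms show "storage_operator T"
    by (simp add: storage_operator_def)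
next
  assume T: "storage_operator T"
  have "\<exists>\<tau>. closed \<tau> \<and> \<tau> \<simeq>\<^sub>\<beta> church n \<and>
      (\<forall>f. run n (XApp (XApp (emb T) (XCon n)) (XVar f)) (XApp (XVar f) (emb \<tau>)))" for n
  proof -
    obtain \<tau> where \<tau>: "closed \<tau>" "\<tau> \<simeq>\<^sub>\<beta> church n"
      and red: "\<And>\<theta> f. \<theta> \<simeq>\<^sub>\<beta> church n \<Longrightarrow> f \<notin> fv \<theta> \<Longrightarrow>
        App (App T \<theta>) (Var f) \<succ> App (Var f) \<tau>"
      using T unfolding storage_operator_def by blast
    have "run n (XApp (XApp (emb T) (XCon n)) (XVar f)) (XApp (XVar f) (emb \<tau>))" for f
    proof (rule realize_run)
      \<comment> \<open>The mark \<open>Suc f\<close> differs from \<open>f\<close>, so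
        \<open>f\<close> is fresh for the marked integer.\<close>
      show "whead\<^sup>*\<^sup>* (realize (XApp (XApp (emb T) (XCon n)) (XVar f)) (Suc f)) (App (Var f) \<tau>)"
        using red[OF marked_beta_eq, of f "Suc f"]
        by (simp add: head_red_iff_whead realize_emb fv_marked)
    qed (use \<tau> in \<open>auto simp: wf_consts_emb\<close>)
    with \<tau> show ?thesis by blast
  qed
  with assms show "S_storage_operator S1 T"
    by (simp add: S_storage_operator_iff_run)
qed

end
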